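(* There is an absolute constant $C>0$ such that for every positive integer $N$ and every Sidon set $S \subset [N]$, $$\sup_{\alpha\in\mathbb{T}}\left|\hat{1}_{S}(\alpha) - \frac{|S|}{N}\hat{1}_{[N]}(\alpha)\right| \leq C\, N^{1/2}\left(\left|1-\frac{|S|}{N^{1/2}}\right|+N^{-1/4}\right)^{1/2}.$$
   Context: $[N]=\{1,2,\dots,N\}$ and $\mathbb{T}=\mathbb{R}/\mathbb{Z}$. A set $S\subset\mathbb{Z}$ is Sidon if every non-zero integer $x$ has at most one representation $x=s_1-s_2$ with $s_1,s_2\in S$. For finitely supported $f:\mathbb{Z}\to\mathbb{C}$, the Fourier transform is $\hat f(\alpha)=\sum_{n\in\mathbb{Z}} f(n)e(\alpha n)$ for $\alpha\in\mathbb{T}$, where $e(\beta)=e^{2\pi i\beta}$. $1_A$ denotes the indicator function of a set $A$. *)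

theory Defs
  imports "HOL-Analysis.Analysis"
begin

definition sidon :: "int set \<Rightarrow> bool" where
  "sidon S \<longleftrightarrow> (\<forall>x. x \<noteq> 0 \<longrightarrow> Uniq (\<lambda>(s1, s2). s1 \<in> S \<and> s2 \<in> S \<and> x = s1 - s2))"

definition e :: "real \<Rightarrow> complex" where
  "e \<beta> = exp (2 * of_real pi * \<i> * of_real \<beta>)"

text \<open>For finitely supported functions only: on infinite support the sum is 0 by convention.
  Functions on the torus \<open>\<real>/\<int>\<close> are represented as 1-periodic functions of a real variable, which the
  transform is by \<open>fourier_add_int\<close>; a supremum over the torus is then one over all reals.\<close>
definition fourier :: "(int \<Rightarrow> complex) \<Rightarrow> real \<Rightarrow> complex" where
  "fourier f \<alpha> = (\<Sum>n | f n \<noteq> 0. f n * e (\<alpha> * of_int n))"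

lemma e_add_int: "e (\<beta> + of_int k) = e \<beta>"
proof -
  have "e (\<beta> + of_int k)
      = exp (2 * of_real pi * \<i> * of_real \<beta> + 2 * of_int k * of_real pi * \<i>)"
    by (simp add: e_def algebra_simps)
  also have "\<dots> = e \<beta>"
    unfolding e_def exp_eq by (rule exI[of _ k]) (simp add: algebra_simps)
  finally show ?thesis .
qed

lemma fourier_add_int: "fourier f (\<alpha> + of_int k) = fourier f \<alpha>"
proof -
  have "e ((\<alpha> + of_int k) * of_int n) = e (\<alpha> * of_int n)" for n
    using e_add_int[of "\<alpha> * of_int n" "k * n"] by (simp add: algebra_simps)
  then show ?thesis by (simp add: fourier_def)
qed

lemma norm_e [simp]: "norm (e \<beta>) = 1"
  by (simp add: e_def)

lemma norm_fourier_le: "norm (fourier f \<alpha>) \<le> (\<Sum>n | f n \<noteq> 0. norm (f n))"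
  unfolding fourier_def by (rule sum_norm_le) (simp add: norm_mult)

text \<open>In particular the real-valued supremum of such a difference is a genuine least upper bound.\<close>
lemma bdd_above_fourier_diff:
  "bdd_above (range (\<lambda>\<alpha>. norm (fourier f \<alpha> - c * fourier g \<alpha>)))"
proof (rule bdd_aboveI2)
  fix \<alpha>
  show "norm (fourier f \<alpha> - c * fourier g \<alpha>)
      \<le> (\<Sum>n | f n \<noteq> 0. norm (f n)) + norm c * (\<Sum>n | g n \<noteq> 0. norm (g n))"
    by (intro order_trans[OF norm_triangle_ineq4] add_mono norm_fourier_le)
       (simp add: norm_mult mult_left_mono norm_fourier_le)
qed

end

(* Cut [N] into windows of length u ~ N^(3/4). Since every nonzero difference occurs at most once in
   a Sidon set S, the second moment of the window counts of S is almost as small as Cauchy-Schwarz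
   permits, so S - S contains almost all differences below u, suitably weighted. Hence, at every
   frequency alpha, the second moment of the twisted window sums of S is close to that of a full
   window, and the window sums are close in L2 to (|S|/N) times the window sums of all integers.
   Averaging over the windows with Cauchy-Schwarz bounds the Fourier transform of the difference,
   up to an edge error of order N^(1/4). *)

theory Submission
  imports Defs
begin

section \<open>The additive character, difference counts and window sums\<close>

lemma e_0 [simp]: "e 0 = 1"
  by (simp add: e_def)

lemma e_add: "e (a + b) = e a * e b"
  by (simp add: e_def algebra_simps flip: exp_add)

lemma cnj_e: "cnj (e a) = e (- a)"
  by (simp add: e_def exp_cnj)

definition diff_count :: "int set \<Rightarrow> int \<Rightarrow> nat" where
  "diff_count S d = card {s \<in> S. s - d \<in> S}"

text \<open>The window is the block of \<open>u\<close> integers ending at \<open>n\<close>, but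
  each phase is taken at the element of \<open>S\<close> itself, so that at frequency 0 the sum is
  the window count of \<open>S\<close>.\<close>

definition window_sum :: "int set \<Rightarrow> nat \<Rightarrow> real \<Rightarrow> int \<Rightarrow> complex" where
  "window_sum S u \<alpha> n = (\<Sum>j\<in>{0..<int u}. of_bool (n - j \<in> S) * e (\<alpha> * of_int (n - j)))"

lemma diff_count_0: "diff_count S 0 = card S"
  by (simp add: diff_count_def)

lemma sidon_diff_count_le:
  assumes "sidon S" "d \<noteq> 0"
  shows "diff_count S d \<le> 1"
proof -
  have "s = t" if "s \<in> S" "s - d \<in> S" "t \<in> S" "t - d \<in> S" for s t
  proof -
    have "Uniq (\<lambda>(s1, s2). s1 \<in> S \<and> s2 \<in> S \<and> d = s1 - s2)"
      using assms by (auto simp: sidon_def)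
    from Uniq_D[OF this, of "(s, s - d)" "(t, t - d)"] show ?thesis using that by simp
  qed
  then have "\<exists>t. {s \<in> S. s - d \<in> S} \<subseteq> {t}" by blast
  then obtain t where "{s \<in> S. s - d \<in> S} \<subseteq> {t}" by blast
  from card_mono[OF _ this] show ?thesis by (simp add: diff_count_def)
qed

section \<open>Moments of the window sums\<close>

text \<open>The points \<open>s + j\<close> fill at most the range from \<open>1\<close> to
  \<open>N + u - 1\<close>, which is exactly the range of \<open>n\<close>; nothing is lost at the
  boundary.\<close>

lemma sum_translate:
  fixes f :: "int \<Rightarrow> complex" and N u :: nat
  assumes "S \<subseteq> {1..int N}" "j \<in> {0..<int u}"
  shows "(\<Sum>n\<in>{1..int (N + u) - 1}. of_bool (n - j \<in> S) * f n) = (\<Sum>s\<in>S. f (s + j))"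
proof -
  have "(\<Sum>n\<in>{1..int (N + u) - 1}. of_bool (n - j \<in> S) * f n)
      = (\<Sum>n\<in>{n \<in> {1..int (N + u) - 1}. n - j \<in> S}. f n)"
    by (rule sum.mono_neutral_cong_right) auto
  also have "\<dots> = (\<Sum>s\<in>S. f (s + j))"
    by (rule sum.reindex_bij_witness[of _ "\<lambda>s. s + j" "\<lambda>n. n - j"])
       (use assms in \<open>auto simp: subset_iff\<close>)
  finally show ?thesis .
qed

text \<open>Serves three weights \<open>g\<close>: the conjugate window sum (second moment), the
  constant 1 (first moment) and a conjugate character (correlation with the model).\<close>

lemma sum_window_sum:
  fixes g :: "int \<Rightarrow> complex"
  assumes "S \<subseteq> {1..int N}"
  shows "(\<Sum>n\<in>{1..int (N + u) - 1}. window_sum S u \<alpha> n * g n)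
      = (\<Sum>j\<in>{0..<int u}. \<Sum>s\<in>S. e (\<alpha> * of_int s) * g (s + j))"
proof -
  have "(\<Sum>n\<in>{1..int (N + u) - 1}. window_sum S u \<alpha> n * g n)
      = (\<Sum>j\<in>{0..<int u}. \<Sum>n\<in>{1..int (N + u) - 1}.
           of_bool (n - j \<in> S) * (e (\<alpha> * of_int (n - j)) * g n))"
    unfolding window_sum_def sum_distrib_right
    by (subst sum.swap) (simp add: mult.assoc)
  also have "\<dots> = (\<Sum>j\<in>{0..<int u}. \<Sum>s\<in>S. e (\<alpha> * of_int s) * g (s + j))"
    by (rule sum.cong[OF refl], subst sum_translate[OF assms]) auto
  finally show ?thesis .
qed

text \<open>A pair of points of \<open>S\<close> in a common window contributes a phase depending
  only on their difference. The double sum gives each difference \<open>d\<close> with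
  \<open>|d| < u\<close> the weight \<open>u - |d|\<close>.\<close>

lemma sum_norm_window_sum_sq:
  assumes "S \<subseteq> {1..int N}"
  shows "complex_of_real (\<Sum>n\<in>{1..int (N + u) - 1}. (norm (window_sum S u \<alpha> n))\<^sup>2)
      = (\<Sum>j\<in>{0..<int u}. \<Sum>i\<in>{0..<int u}.
           of_nat (diff_count S (i - j)) * e (\<alpha> * of_int (i - j)))"
proof -
  have fin: "finite S" using assms finite_subset by blast
  have "complex_of_real (\<Sum>n\<in>{1..int (N + u) - 1}. (norm (window_sum S u \<alpha> n))\<^sup>2)
      = (\<Sum>n\<in>{1..int (N + u) - 1}. window_sum S u \<alpha> n * cnj (window_sum S u \<alpha> n))"
    by (simp add: complex_norm_square del: of_real_power)
  also have "\<dots> = (\<Sum>j\<in>{0..<int u}. \<Sum>s\<in>S.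
      e (\<alpha> * of_int s) * cnj (window_sum S u \<alpha> (s + j)))"
    by (rule sum_window_sum[OF assms])
  also have "\<dots> = (\<Sum>j\<in>{0..<int u}. \<Sum>i\<in>{0..<int u}. \<Sum>s\<in>S.
      of_bool (s - (i - j) \<in> S) * e (\<alpha> * of_int (i - j)))"
  proof (rule sum.cong[OF refl])
    fix j
    have "e (\<alpha> * of_int s) * (of_bool b * e (- (\<alpha> * of_int (s + j - i))))
        = of_bool b * e (\<alpha> * of_int (i - j))" for s i b
      using e_add[of "\<alpha> * of_int s" "- (\<alpha> * of_int (s + j - i))"]
      by (simp add: algebra_simps)
    then show "(\<Sum>s\<in>S. e (\<alpha> * of_int s) * cnj (window_sum S u \<alpha> (s + j)))
       = (\<Sum>i\<in>{0..<int u}. \<Sum>s\<in>S. of_bool (s - (i - j) \<in> S) * e (\<alpha> * of_int (i - j)))"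
      unfolding window_sum_def
      by (subst sum.swap) (simp add: sum_distrib_left cnj_e algebra_simps)
  qed
  also have "\<dots> = (\<Sum>j\<in>{0..<int u}. \<Sum>i\<in>{0..<int u}.
           of_nat (diff_count S (i - j)) * e (\<alpha> * of_int (i - j)))"
    using fin by (intro sum.cong refl)
      (simp add: diff_count_def Int_def flip: sum_distrib_right)
  finally show ?thesis .
qed

text \<open>The differences of a Sidon set are counted at most once, so the defect of their (weighted)
  number from \<open>u\<^sup>2\<close> controls the error at every frequency.\<close>

lemma sidon_window_sum_sq_approx:
  assumes "S \<subseteq> {1..int N}" "sidon S"
  shows "\<bar>(\<Sum>n\<in>{1..int (N + u) - 1}. (norm (window_sum S u \<alpha> n))\<^sup>2)
          - (norm (\<Sum>j\<in>{0..<int u}. e (- (\<alpha> * of_int j))))\<^sup>2\<bar>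
      \<le> real u ^ 2 - (\<Sum>n\<in>{1..int (N + u) - 1}. (norm (window_sum S u 0 n))\<^sup>2)
        + 2 * real u * real (card S)"
proof -
  let ?J = "{0..<int u}"
  let ?r = "\<lambda>d. real (diff_count S d)"
  define D where "D = (\<Sum>j\<in>?J. e (- (\<alpha> * of_int j)))"
  define T where "T = (\<lambda>\<alpha>. \<Sum>n\<in>{1..int (N + u) - 1}. (norm (window_sum S u \<alpha> n))\<^sup>2)"
  have T: "complex_of_real (T \<alpha>) = (\<Sum>j\<in>?J. \<Sum>i\<in>?J. of_real (?r (i - j)) * e (\<alpha> * of_int (i - j)))"
    for \<alpha> using sum_norm_window_sum_sq[OF assms(1), of u \<alpha>] by (simp add: T_def)
  have "complex_of_real (T 0) = complex_of_real (\<Sum>j\<in>?J. \<Sum>i\<in>?J. ?r (i - j))"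
    by (subst T) simp
  then have T0: "T 0 = (\<Sum>j\<in>?J. \<Sum>i\<in>?J. ?r (i - j))"
    by (simp only: of_real_eq_iff)
  \<comment> \<open>\<open>(norm D)^2\<close> is the value of the second moment if every difference,
    0 included, had exactly one representation.\<close>
  have "complex_of_real ((norm D)\<^sup>2) = D * cnj D"
    by (simp add: complex_norm_square del: of_real_power)
  also have "\<dots> = (\<Sum>j\<in>?J. \<Sum>i\<in>?J. e (\<alpha> * of_int (i - j)))"
    unfolding D_def cnj_sum sum_product
    by (simp add: cnj_e algebra_simps flip: e_add)
  finally have D: "complex_of_real ((norm D)\<^sup>2) = (\<Sum>j\<in>?J. \<Sum>i\<in>?J. e (\<alpha> * of_int (i - j)))" .
  have "\<bar>T \<alpha> - (norm D)\<^sup>2\<bar> = norm (complex_of_real (T \<alpha>) - complex_of_real ((norm D)\<^sup>2))"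
    by (metis norm_of_real of_real_diff)
  also have "\<dots> = norm (\<Sum>j\<in>?J. \<Sum>i\<in>?J. of_real (?r (i - j) - 1) * e (\<alpha> * of_int (i - j)))"
    unfolding T D by (simp add: sum_subtractf algebra_simps)
  also have "\<dots> \<le> (\<Sum>j\<in>?J. \<Sum>i\<in>?J. \<bar>?r (i - j) - 1\<bar>)"
    by (intro sum_norm_le) (simp add: norm_mult del: of_real_diff)
  \<comment> \<open>Off the diagonal the Sidon property fixes the sign of \<open>?r - 1\<close>, so
    the absolute value opens up. On the diagonal \<open>?r\<close> is \<open>card S\<close>, and the
    \<open>u\<close> corrections there give the term \<open>2 * u * card S\<close>.\<close>
  also have "\<dots> \<le> (\<Sum>j\<in>?J. \<Sum>i\<in>?J. 1 - ?r (i - j) + (if i = j then 2 * real (card S) else 0))"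
  proof (intro sum_mono)
    fix i j
    show "\<bar>?r (i - j) - 1\<bar> \<le> 1 - ?r (i - j) + (if i = j then 2 * real (card S) else 0)"
    proof (cases "i = j")
      case False
      then have "diff_count S (i - j) \<le> 1" by (intro sidon_diff_count_le assms) auto
      with False show ?thesis by simp
    qed (simp add: diff_count_0)
  qed
  also have "\<dots> = real u ^ 2 - T 0 + 2 * real u * real (card S)"
    by (simp add: T0 sum.distrib sum_subtractf power2_eq_square)
  finally show ?thesis by (simp add: T_def D_def)
qed

section \<open>Cauchy-Schwarz at frequency 0, the size of a Sidon set, and the window
  variance\<close>

lemma sum_window_sum_0:
  assumes "S \<subseteq> {1..int N}"
  shows "(\<Sum>n\<in>{1..int (N + u) - 1}. window_sum S u 0 n) = of_nat (u * card S)"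
  using sum_window_sum[OF assms, of u 0 "\<lambda>_. 1"] by simp

lemma norm_sum_sq_le:
  fixes f :: "'a \<Rightarrow> 'b::real_normed_vector"
  shows "(norm (\<Sum>n\<in>A. f n))\<^sup>2 \<le> real (card A) * (\<Sum>n\<in>A. (norm (f n))\<^sup>2)"
proof -
  have "(norm (\<Sum>n\<in>A. f n))\<^sup>2 \<le> (\<Sum>n\<in>A. norm (f n))\<^sup>2"
    by (intro power_mono norm_sum) simp
  also have "\<dots> \<le> (\<Sum>n\<in>A. (norm (f n))\<^sup>2) * (\<Sum>n\<in>A. 1\<^sup>2)"
    using Cauchy_Schwarz_ineq_sum[of "\<lambda>n. norm (f n)" "\<lambda>_. 1" A] by simp
  finally show ?thesis by (simp add: mult.commute)
qed

text \<open>Cauchy-Schwarz over the \<open>N + u - 1\<close> windows, whose counts add up to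
  \<open>u * card S\<close>.\<close>

lemma window_sum_0_sq_ge:
  assumes "S \<subseteq> {1..int N}" "N \<ge> 1"
  shows "(real u * real (card S))\<^sup>2 / real (N + u)
      \<le> (\<Sum>n\<in>{1..int (N + u) - 1}. (norm (window_sum S u 0 n))\<^sup>2)" (is "_ \<le> ?T")
proof -
  have "(real u * real (card S))\<^sup>2 \<le> real (N + u - 1) * ?T"
    using norm_sum_sq_le[of "window_sum S u 0" "{1..int (N + u) - 1}"] assms(2)
    unfolding sum_window_sum_0[OF assms(1)] norm_of_nat by (simp add: nat_diff_distrib)
  also have "\<dots> \<le> real (N + u) * ?T"
    by (intro mult_right_mono sum_nonneg) auto
  finally show ?thesis using assms(2) by (simp add: field_simps)
qed

text \<open>Take \<open>u = N\<close> at frequency 0: the second moment is at most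
  \<open>u^2 + 2 * u * card S\<close>, because the left side of the approximation is nonnegative,
  and Cauchy-Schwarz bounds it below. Only the order of magnitude matters later, so the constant is
  crude.\<close>

lemma sidon_card_le:
  assumes "S \<subseteq> {1..int N}" "N \<ge> 1" "sidon S"
  shows "real (card S) \<le> 6 * sqrt (real N)"
proof (rule ccontr)
  let ?k = "real (card S)"
  assume neg: "\<not> ?thesis"
  have "(real N * ?k)\<^sup>2 / real (N + N) \<le> real N ^ 2 + 2 * real N * ?k"
    using window_sum_0_sq_ge[OF assms(1,2), of N] sidon_window_sum_sq_approx[OF assms(1,3), of N 0]
    by linarith
  then have "real N * ?k\<^sup>2 \<le> real N * (2 * real N + 4 * ?k)"
    using assms(2) by (simp add: field_simps power2_eq_square)
  then have "?k\<^sup>2 \<le> 2 * real N + 4 * ?k" using assms(2) by (simp add: mult_le_cancel_left)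
  moreover have "1 \<le> sqrt (real N)" using assms(2) by simp
  \<comment> \<open>Were \<open>?k > 6 * sqrt N\<close>, the bound \<open>2 * N + 4 * ?k\<close>
    would be at most \<open>?k^2 / 18 + 2 * ?k^2 / 3\<close>, which is below
    \<open>?k^2\<close>.\<close>
  moreover have "real N \<le> (?k / 6)\<^sup>2"
    using neg power_mono[of "sqrt (real N)" "?k / 6" 2] by simp
  moreover have "6 * ?k \<le> ?k\<^sup>2"
  proof -
    have "6 \<le> ?k" using neg \<open>1 \<le> sqrt (real N)\<close> by linarith
    then show ?thesis unfolding power2_eq_square by (intro mult_right_mono) auto
  qed
  ultimately show False using neg by (simp add: power_divide)
qed

text \<open>The model for a window sum is \<open>c\<close> times the window sum of all integers, not of the interval:
  its correlation with the window sums of \<open>S\<close> is then exact, without boundary terms.\<close>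

lemma sidon_window_sum_variance:
  fixes N u :: nat and \<alpha> :: real
  assumes "S \<subseteq> {1..int N}" "N \<ge> 1" "sidon S"
  defines "k \<equiv> real (card S)"
  defines "D \<equiv> \<Sum>j\<in>{0..<int u}. e (- (\<alpha> * of_int j))"
  shows "(\<Sum>n\<in>{1..int (N + u) - 1}.
            (norm (window_sum S u \<alpha> n - of_real (k / real N) * e (\<alpha> * of_int n) * D))\<^sup>2)
      \<le> 2 * real u ^ 2 * (\<bar>1 - k\<^sup>2 / real N\<bar> + k\<^sup>2 * real u / real N ^ 2) + 2 * real u * k"
proof -
  let ?W = "{1..int (N + u) - 1}"
  let ?w = "window_sum S u \<alpha>"
  define c where "c = k / real N"
  define T where "T = (\<lambda>\<alpha>. \<Sum>n\<in>?W. (norm (window_sum S u \<alpha> n))\<^sup>2)"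
  have N: "real N > 0" using assms(2) by simp
  have sq: "(norm (?w n - of_real c * e (\<alpha> * of_int n) * D))\<^sup>2
     = (norm (?w n))\<^sup>2 - 2 * c * Re (?w n * e (- (\<alpha> * of_int n)) * cnj D) + c\<^sup>2 * (norm D)\<^sup>2" for n
  proof -
    have "(norm (x - y))\<^sup>2 = (norm x)\<^sup>2 - 2 * Re (x * cnj y) + (norm y)\<^sup>2" for x y
      unfolding cmod_power2 by (simp add: power2_eq_square algebra_simps)
    moreover have "?w n * cnj (of_real c * e (\<alpha> * of_int n) * D)
        = of_real c * (?w n * e (- (\<alpha> * of_int n)) * cnj D)"
      by (simp add: cnj_e mult_ac)
    then have "Re (?w n * cnj (of_real c * e (\<alpha> * of_int n) * D))
        = c * Re (?w n * e (- (\<alpha> * of_int n)) * cnj D)"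
      by (simp only: times_complex.sel Re_complex_of_real Im_complex_of_real)
    moreover have "(norm (of_real c * e (\<alpha> * of_int n) * D))\<^sup>2 = c\<^sup>2 * (norm D)\<^sup>2"
      by (simp add: norm_mult power_mult_distrib)
    ultimately show ?thesis by (simp only: mult.assoc)
  qed
  \<comment> \<open>At \<open>n = s + j\<close> the phase of \<open>s\<close> cancels, so each
    element of \<open>S\<close> contributes one full copy of \<open>D\<close>.\<close>
  have corr: "(\<Sum>n\<in>?W. ?w n * e (- (\<alpha> * of_int n))) = of_real k * D"
  proof -
    have "(\<Sum>n\<in>?W. ?w n * e (- (\<alpha> * of_int n)))
        = (\<Sum>j\<in>{0..<int u}. \<Sum>s\<in>S. e (- (\<alpha> * of_int j)))"
      by (subst sum_window_sum[OF assms(1)]) (simp add: algebra_simps flip: e_add)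
    then show ?thesis by (simp add: D_def k_def sum_distrib_left)
  qed
  have "(\<Sum>n\<in>?W. Re (?w n * e (- (\<alpha> * of_int n)) * cnj D))
      = Re ((\<Sum>n\<in>?W. ?w n * e (- (\<alpha> * of_int n))) * cnj D)"
    by (simp only: sum_distrib_right Re_sum)
  also have "\<dots> = Re (of_real k * of_real ((norm D)\<^sup>2))"
    by (simp only: corr complex_norm_square mult.assoc)
  also have "\<dots> = k * (norm D)\<^sup>2" by (simp del: of_real_power)
  finally have cross: "(\<Sum>n\<in>?W. Re (?w n * e (- (\<alpha> * of_int n)) * cnj D)) = k * (norm D)\<^sup>2" .
  have "(\<Sum>n\<in>?W. (norm (?w n - of_real c * e (\<alpha> * of_int n) * D))\<^sup>2)
      = T \<alpha> - 2 * c * (k * (norm D)\<^sup>2) + real (N + u - 1) * (c\<^sup>2 * (norm D)\<^sup>2)"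
  proof -
    have "(\<Sum>n\<in>?W. 2 * c * Re (?w n * e (- (\<alpha> * of_int n)) * cnj D)) = 2 * c * (k * (norm D)\<^sup>2)"
      unfolding cross[symmetric] by (rule sum_distrib_left[symmetric])
    moreover have "(\<Sum>n\<in>?W. c\<^sup>2 * (norm D)\<^sup>2) = real (N + u - 1) * (c\<^sup>2 * (norm D)\<^sup>2)"
      using assms(2) by (simp add: nat_diff_distrib)
    ultimately show ?thesis
      unfolding sq sum.distrib sum_subtractf T_def by (simp only:)
  qed
  also have "\<dots> \<le> T \<alpha> - 2 * c * (k * (norm D)\<^sup>2) + real (N + u) * (c\<^sup>2 * (norm D)\<^sup>2)"
    by (intro add_left_mono mult_right_mono) auto
  \<comment> \<open>The choice \<open>c = k / N\<close> minimizes
    \<open>N * c^2 - 2 * c * k\<close>, with value \<open>- k^2 / N\<close>; the remaining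
    \<open>u * c^2\<close> is the cost of the extra windows.\<close>
  also have "\<dots> = T \<alpha> - (norm D)\<^sup>2 + (norm D)\<^sup>2 * (1 - k\<^sup>2 / real N + k\<^sup>2 * real u / real N ^ 2)"
    using N by (simp add: c_def field_simps power2_eq_square)
  also have "\<dots> \<le> (real u ^ 2 * (1 - k\<^sup>2 / real N + k\<^sup>2 * real u / real N ^ 2) + 2 * real u * k)
      + real u ^ 2 * (\<bar>1 - k\<^sup>2 / real N\<bar> + k\<^sup>2 * real u / real N ^ 2)"
  proof (rule add_mono)
    \<comment> \<open>Linearizing \<open>1 / (N + u)\<close> brings the defect
      \<open>u^2 - T 0\<close> to the same shape as the factor in the second summand.\<close>
    have "1 / real N - real u / real N ^ 2 \<le> 1 / real (N + u)"
      using N by (simp add: field_simps power2_eq_square)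
    then have "(real u * k)\<^sup>2 * (1 / real N - real u / real N ^ 2) \<le> (real u * k)\<^sup>2 * (1 / real (N + u))"
      by (intro mult_left_mono) auto
    also have "\<dots> \<le> T 0"
      using window_sum_0_sq_ge[OF assms(1,2), of u] by (simp add: T_def k_def)
    finally have "real u ^ 2 - T 0 \<le> real u ^ 2 * (1 - k\<^sup>2 / real N + k\<^sup>2 * real u / real N ^ 2)"
      by (simp add: algebra_simps power_mult_distrib)
    then show "T \<alpha> - (norm D)\<^sup>2 \<le> real u ^ 2 * (1 - k\<^sup>2 / real N + k\<^sup>2 * real u / real N ^ 2) + 2 * real u * k"
      using sidon_window_sum_sq_approx[OF assms(1,3), of u \<alpha>]
      unfolding T_def D_def k_def by linarith
    have "norm D \<le> real u"
      unfolding D_def by (rule order_trans[OF norm_sum]) simp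
    then have "(norm D)\<^sup>2 \<le> real u ^ 2" by (intro power_mono) auto
    then show "(norm D)\<^sup>2 * (1 - k\<^sup>2 / real N + k\<^sup>2 * real u / real N ^ 2)
        \<le> real u ^ 2 * (\<bar>1 - k\<^sup>2 / real N\<bar> + k\<^sup>2 * real u / real N ^ 2)"
      by (intro order_trans[OF mult_left_mono mult_right_mono]) auto
  qed
  also have "\<dots> \<le> 2 * real u ^ 2 * (\<bar>1 - k\<^sup>2 / real N\<bar> + k\<^sup>2 * real u / real N ^ 2) + 2 * real u * k"
    using mult_left_mono[OF abs_ge_self[of "1 - k\<^sup>2 / real N"], of "real u ^ 2"]
    by (simp add: algebra_simps)
  finally show ?thesis by (simp add: c_def)
qed

section \<open>Edge effects and the final estimate\<close>

text \<open>The shifted range contains \<open>{1..N}\<close> and has only \<open>u - 1\<close>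
  further points, each contributing a term of norm 1.\<close>

lemma norm_sum_e_shift_le:
  assumes "j \<in> {0..<int u}"
  shows "norm ((\<Sum>n\<in>{1..int (N + u) - 1}. e (\<alpha> * of_int (n - j)))
      - (\<Sum>n\<in>{1..int N}. e (\<alpha> * of_int n))) \<le> real u"
proof -
  let ?V = "{1 - j..int (N + u) - 1 - j}"
  have sub: "{1..int N} \<subseteq> ?V" using assms by auto
  have "(\<Sum>n\<in>{1..int (N + u) - 1}. e (\<alpha> * of_int (n - j))) = (\<Sum>m\<in>?V. e (\<alpha> * of_int m))"
    by (rule sum.reindex_bij_witness[of _ "\<lambda>m. m + j" "\<lambda>n. n - j"]) auto
  then have "(\<Sum>n\<in>{1..int (N + u) - 1}. e (\<alpha> * of_int (n - j)))
      - (\<Sum>n\<in>{1..int N}. e (\<alpha> * of_int n)) = (\<Sum>m\<in>?V - {1..int N}. e (\<alpha> * of_int m))"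
    by (subst sum_diff[OF _ sub]) simp_all
  also have "norm \<dots> \<le> real (card (?V - {1..int N}))"
    by (rule order_trans[OF norm_sum]) simp
  also have "\<dots> \<le> real u"
    using assms by (subst card_Diff_subset[OF _ sub]) auto
  finally show ?thesis .
qed

lemma fourier_indicator:
  assumes "finite A"
  shows "fourier (indicator A) \<alpha> = (\<Sum>n\<in>A. e (\<alpha> * of_int n))"
  by (auto simp: fourier_def indicator_def intro: sum.cong)

lemma sidon_fourier_bound:
  fixes N :: nat
  assumes "S \<subseteq> {1..int N}" "N \<ge> 1" "sidon S"
  shows "norm (fourier (indicator S) \<alpha>
          - of_real (real (card S) / real N) * fourier (indicator {1..int N}) \<alpha>)
      \<le> 30 * sqrt (real N) *
          sqrt (\<bar>1 - real (card S) / sqrt (real N)\<bar> + real N powr (- 1/4))"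
proof -
  define k where "k = real (card S)"
  define c where "c = k / real N"
  \<comment> \<open>As \<open>k\<close> is at most of order \<open>sqrt N\<close>, the relative
    errors are of order \<open>u / N\<close> (edges) and \<open>sqrt N / u\<close> (diagonal). They
    balance at \<open>N powr (3/4)\<close>, where both have the order of
    \<open>\<eta>\<close>.\<close>
  define u where "u = nat \<lceil>real N powr (3/4)\<rceil>"
  define \<eta> where "\<eta> = real N powr (- 1/4)"
  define x where "x = k / sqrt (real N)"
  define \<epsilon> where "\<epsilon> = \<bar>1 - x\<bar> + \<eta>"
  let ?W = "{1..int (N + u) - 1}"
  let ?J = "{0..<int u}"
  define D where "D = (\<Sum>j\<in>?J. e (- (\<alpha> * of_int j)))"
  define F where "F = fourier (indicator S) \<alpha>"
  define I where "I = fourier (indicator {1..int N}) \<alpha>"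
  define G where "G = (\<lambda>n. window_sum S u \<alpha> n - of_real c * e (\<alpha> * of_int n) * D)"
  have N: "real N \<ge> 1" using assms(2) by simp
  have sqrtN: "sqrt (real N) = real N powr (1/2)" by (simp add: powr_half_sqrt)
  have N34: "real N powr (3/4) \<ge> 1" using N by (simp add: ge_one_powr_ge_zero)
  have u_ge: "real N powr (3/4) \<le> real u" unfolding u_def by linarith
  have u_le: "real u \<le> 2 * real N powr (3/4)" unfolding u_def using N34 by linarith
  have u_pos: "real u \<ge> 1" using u_ge N34 by linarith
  have "real N powr (3/4) \<le> real N powr 1" using N by (intro powr_mono) auto
  then have uN: "u \<le> N" unfolding u_def using N by (simp add: ceiling_le_iff)
  have \<eta>: "0 \<le> \<eta>" "\<eta> \<le> 1" using N powr_mono[of "-1/4" 0 "real N"] by (auto simp: \<eta>_def)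
  have \<eta>N: "\<eta> * real N = real N powr (3/4)" "\<eta> * real N powr (3/4) = sqrt (real N)"
    unfolding sqrtN \<eta>_def using N by (simp_all add: powr_mult_base powr_add[symmetric] mult.commute)
  have k0: "k \<ge> 0" by (simp add: k_def)
  have k_le: "k \<le> 6 * sqrt (real N)" using sidon_card_le[OF assms] by (simp add: k_def)
  have x: "0 \<le> x" "x \<le> 6" using k_le k0 N by (auto simp: x_def field_simps)
  have xsq: "k\<^sup>2 / real N = x\<^sup>2" using N by (simp add: x_def power_divide)
  have \<epsilon>0: "\<epsilon> \<ge> 0" using \<eta> by (simp add: \<epsilon>_def)

  have "(\<Sum>n\<in>?W. (norm (G n))\<^sup>2)
      \<le> 2 * real u ^ 2 * (\<bar>1 - k\<^sup>2 / real N\<bar> + k\<^sup>2 * real u / real N ^ 2) + 2 * real u * k"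
    using sidon_window_sum_variance[OF assms, of u \<alpha>] by (simp add: G_def D_def c_def k_def)
  \<comment> \<open>From \<open>x \<le> 6\<close> comes \<open>1 + x \<le> 7\<close>; with
    \<open>u / N \<le> 2 * \<eta>\<close> it gives \<open>72 = 6^2 * 2\<close>. The 12 comes from
    \<open>k \<le> 6 * \<eta> * u\<close>.\<close>
  also have "\<dots> \<le> 2 * real u ^ 2 * (7 * \<bar>1 - x\<bar> + 72 * \<eta>) + real u ^ 2 * (12 * \<eta>)"
  proof (intro add_mono mult_left_mono)
    have "\<bar>1 - x\<^sup>2\<bar> = (1 + x) * \<bar>1 - x\<bar>"
      using x abs_mult[of "1 + x" "1 - x"] by (simp add: power2_eq_square algebra_simps)
    also have "\<dots> \<le> 7 * \<bar>1 - x\<bar>" using x by (intro mult_right_mono) auto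
    finally show "\<bar>1 - k\<^sup>2 / real N\<bar> \<le> 7 * \<bar>1 - x\<bar>" by (simp add: xsq)
    have "k\<^sup>2 * real u / real N ^ 2 = x\<^sup>2 * (real u / real N)"
      unfolding xsq[symmetric] by (simp add: power2_eq_square)
    also have "\<dots> \<le> 6\<^sup>2 * (2 * \<eta>)"
    proof (intro mult_mono power_mono x)
      show "real u / real N \<le> 2 * \<eta>" using u_le \<eta>N N by (simp add: field_simps)
    qed (use N in auto)
    finally show "k\<^sup>2 * real u / real N ^ 2 \<le> 72 * \<eta>" by simp
    have "k \<le> 6 * (\<eta> * real N powr (3/4))" using k_le by (simp add: \<eta>N)
    also have "\<dots> \<le> 6 * (\<eta> * real u)" using \<eta> u_ge by (intro mult_left_mono) auto
    finally have "real u * (2 * k) \<le> real u * (12 * (\<eta> * real u))"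
      by (intro mult_left_mono) auto
    then show "2 * real u * k \<le> real u ^ 2 * (12 * \<eta>)"
      by (simp add: power2_eq_square mult_ac)
  qed auto
  also have "\<dots> = real u ^ 2 * (14 * \<bar>1 - x\<bar> + 156 * \<eta>)" by (simp add: algebra_simps)
  also have "\<dots> \<le> real u ^ 2 * (156 * \<epsilon>)"
    by (intro mult_left_mono) (auto simp: \<epsilon>_def)
  finally have var: "(\<Sum>n\<in>?W. (norm (G n))\<^sup>2) \<le> real u ^ 2 * (156 * \<epsilon>)" .

  have "(norm (\<Sum>n\<in>?W. G n))\<^sup>2 \<le> real (card ?W) * (\<Sum>n\<in>?W. (norm (G n))\<^sup>2)"
    by (rule norm_sum_sq_le)
  also have "\<dots> \<le> (2 * real N) * (real u ^ 2 * (156 * \<epsilon>))"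
    using uN by (intro mult_mono var sum_nonneg) auto
  \<comment> \<open>Here \<open>18^2 = 324\<close> exceeds \<open>2 * 156 = 312\<close>.\<close>
  also have "\<dots> \<le> (real u * (18 * sqrt (real N) * sqrt \<epsilon>))\<^sup>2"
    using \<epsilon>0 by (simp add: power_mult_distrib mult_right_mono)
  finally have sumG: "norm (\<Sum>n\<in>?W. G n) \<le> real u * (18 * sqrt (real N) * sqrt \<epsilon>)"
    using \<epsilon>0 by (auto intro: power2_le_imp_le)

  have finS: "finite S" using assms(1) finite_subset by blast
  have sumw: "(\<Sum>n\<in>?W. window_sum S u \<alpha> n) = of_nat u * F"
    using sum_window_sum[OF assms(1), of u \<alpha> "\<lambda>_. 1"]
    by (simp add: F_def fourier_indicator[OF finS])
  \<comment> \<open>Multiplying by the \<open>j\<close>-th term of \<open>D\<close> shifts the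
    character by \<open>j\<close>, so the models add up to \<open>u\<close> shifted sums, each
    within \<open>u\<close> of \<open>I\<close>.\<close>
  have "(\<Sum>n\<in>?W. e (\<alpha> * of_int n) * D) = (\<Sum>j\<in>?J. \<Sum>n\<in>?W. e (\<alpha> * of_int (n - j)))"
    unfolding D_def sum_distrib_left
    by (subst sum.swap) (simp add: algebra_simps flip: e_add)
  then have "norm ((\<Sum>n\<in>?W. e (\<alpha> * of_int n) * D) - of_nat u * I)
      = norm (\<Sum>j\<in>?J. (\<Sum>n\<in>?W. e (\<alpha> * of_int (n - j))) - I)"
    by (simp add: sum_subtractf)
  also have "\<dots> \<le> (\<Sum>j\<in>?J. real u)"
    by (intro sum_norm_le) (use norm_sum_e_shift_le in \<open>simp add: I_def fourier_indicator\<close>)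
  finally have edge: "norm ((\<Sum>n\<in>?W. e (\<alpha> * of_int n) * D) - of_nat u * I) \<le> real u * real u"
    by simp
  have "of_nat u * (F - of_real c * I)
      = (\<Sum>n\<in>?W. G n) + of_real c * ((\<Sum>n\<in>?W. e (\<alpha> * of_int n) * D) - of_nat u * I)"
    unfolding G_def sum_subtractf sumw by (simp add: sum_distrib_left algebra_simps)
  then have "real u * norm (F - of_real c * I) = norm ((\<Sum>n\<in>?W. G n)
      + of_real c * ((\<Sum>n\<in>?W. e (\<alpha> * of_int n) * D) - of_nat u * I))"
    by (metis norm_mult norm_of_nat)
  also have "\<dots> \<le> real u * (18 * sqrt (real N) * sqrt \<epsilon>) + c * (real u * real u)"
  proof (rule order_trans[OF norm_triangle_ineq add_mono[OF sumG]])
    show "norm (of_real c * ((\<Sum>n\<in>?W. e (\<alpha> * of_int n) * D) - of_nat u * I)) \<le> c * (real u * real u)"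
      unfolding norm_mult norm_of_real using k0 by (intro mult_mono edge) (auto simp: c_def)
  qed
  also have "\<dots> = real u * (18 * sqrt (real N) * sqrt \<epsilon> + c * real u)"
    by (simp add: algebra_simps)
  finally have "norm (F - of_real c * I) \<le> 18 * sqrt (real N) * sqrt \<epsilon> + c * real u"
    using u_pos by (simp add: mult_le_cancel_left)
  \<comment> \<open>The edge error has order \<open>sqrt N * \<eta>\<close>, and
    \<open>\<eta> \<le> 1\<close> gives \<open>\<eta>^2 \<le> \<eta> \<le> \<epsilon>\<close>, so it
    is absorbed. The final constant is \<open>30 = 18 + 12\<close>.\<close>
  also have "c * real u \<le> 12 * sqrt (real N) * sqrt \<epsilon>"
  proof -
    have "c * real u = k * (real u / real N)" by (simp add: c_def)
    also have "\<dots> \<le> (6 * sqrt (real N)) * (2 * \<eta>)"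
      using u_le \<eta>N N k_le k0 \<eta> by (intro mult_mono) (auto simp: field_simps)
    also have "\<eta> \<le> sqrt \<epsilon>"
    proof (rule real_le_rsqrt)
      have "\<eta>\<^sup>2 \<le> \<eta>" using \<eta> by (simp add: power2_eq_square mult_left_le)
      then show "\<eta>\<^sup>2 \<le> \<epsilon>" by (simp add: \<epsilon>_def)
    qed
    finally show ?thesis by (simp add: mult_left_mono)
  qed
  finally show ?thesis
    by (simp add: F_def I_def c_def k_def \<epsilon>_def x_def \<eta>_def)
qed

theorem theorem6p3:
  shows "\<exists>C::real. C > 0 \<and>
    (\<forall>(N::nat) (S::int set). N \<ge> 1 \<longrightarrow> S \<subseteq> {1..int N} \<longrightarrow> sidon S \<longrightarrow>
      (SUP \<alpha>::real. norm (fourier (indicator S) \<alpha>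
          - of_real (real (card S) / real N) * fourier (indicator {1..int N}) \<alpha>))
      \<le> C * sqrt (real N) *
          sqrt (\<bar>1 - real (card S) / sqrt (real N)\<bar> + real N powr (- 1/4)))"
  by (intro exI[of _ 30] conjI allI impI cSUP_least sidon_fourier_bound) simp_all

end
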